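(* For every integer $i \geq 2$ the following hold: (a) there exist positive integers $\alpha_1,\dots,\alpha_i$ with $\alpha_j \mid N_j$ and $\alpha_j > 1$ for all $1 \leq j \leq i$, such that $O(c_i) = \prod_{j=1}^{i} \alpha_j$; (b) there exist positive integers $\beta_1,\dots,\beta_i$ with $\beta_j \mid N_j$ and $\beta_j > 1$ for all $1 \leq j \leq i$, such that $O(a_i) = \prod_{j=1}^{i} \beta_j$.
   Context: Conway's tower of finite fields of characteristic two: $c_{-1} = 1$, $L_{-1} = F_2(c_{-1}) = F_2$ (the field with 2 elements); for $i \geq -1$, $L_{i+1} = L_i(c_{i+1})$, where $c_{i+1}$ satisfies $c_{i+1}^2 + c_{i+1} + \prod_{j=-1}^{i} c_j = 0$. Each $L_{i+1}$ is a quadratic extension of $L_i$, so for $i\ge 0$ the multiplicative group $L_i^* = L_i\setminus\{0\}$ has $2^{2^{i+1}}-1$ elements. Put $a_k = \prod_{j=0}^{k} c_j$ for $k \geq 0$, and let $N_j = 2^{2^j}+1$ ($j \geq 0$) be the Fermat numbers. $O(x)$ denotes the multiplicative order of a nonzero element $x$. *)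

theory Defs
  imports "HOL-Algebra.Algebra"
begin

text \<open>
  The tower lives inside an arbitrary ambient field \<open>R\<close>; it is indexed by the integers
  \<open>i \<ge> -1\<close>, and the values of \<open>L\<close> and \<open>c\<close> below \<open>-1\<close> are irrelevant.  The subfield
  \<open>L (-1)\<close> with two elements is the prime field, so \<open>R\<close> has characteristic two.  At each
  step \<open>c (i + 1)\<close> may be either root of its quadratic polynomial.  That every step is
  a quadratic extension is a consequence of the axioms and is not assumed.
\<close>

locale conway_tower = field R for R :: "('a, 'b) ring_scheme" (structure) +
  fixes L :: "int \<Rightarrow> 'a set" and c :: "int \<Rightarrow> 'a"
  assumes base_subfield: "subfield (L (-1)) R"
    and base_card: "card (L (-1)) = 2"
    and base_one: "c (-1) = \<one>"
    and c_closed: "i \<ge> -1 \<Longrightarrow> c (i + 1) \<in> carrier R"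
    and c_root: "i \<ge> -1 \<Longrightarrow>
      c (i + 1) [^] (2::nat) \<oplus> c (i + 1) \<oplus> (\<Otimes>j\<in>{-1..i}. c j) = \<zero>"
    and tower_step: "i \<ge> -1 \<Longrightarrow> L (i + 1) = generate_field R (insert (c (i + 1)) (L i))"

definition tower_prod :: "('a, 'b) ring_scheme \<Rightarrow> (int \<Rightarrow> 'a) \<Rightarrow> int \<Rightarrow> 'a" where
  "tower_prod R c k = (\<Otimes>\<^bsub>R\<^esub>j\<in>{0..k}. c j)"

definition fermat_number :: "nat \<Rightarrow> nat" where
  "fermat_number j = 2 ^ (2 ^ j) + 1"

definition mult_order :: "('a, 'b) ring_scheme \<Rightarrow> 'a \<Rightarrow> nat" where
  "mult_order R x = group.ord (mult_of R) x"

end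

theory Submission
  imports Defs
begin

text \<open>
  Put \<open>q = 2 ^ 2 ^ (i + 1)\<close>. Iterating \<open>c\<^sub>i\<^sub>+\<^sub>1\<^sup>2 = c\<^sub>i\<^sub>+\<^sub>1 + a\<^sub>i\<close> gives
  \<open>c\<^sub>i\<^sub>+\<^sub>1\<^sup>q = c\<^sub>i\<^sub>+\<^sub>1 + Tr a\<^sub>i\<close>, where \<open>Tr\<close> is the sum of the first \<open>2 ^ (i + 1)\<close> iterated squares.
  Since \<open>Tr a\<^sub>i = 1\<close> by induction, \<open>c\<^sub>i\<^sub>+\<^sub>1\<^sup>q = c\<^sub>i\<^sub>+\<^sub>1 + 1\<close>, so that \<open>c\<^sub>i\<^sub>+\<^sub>1\<close> and \<open>a\<^sub>i\<^sub>+\<^sub>1\<close> are not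
  fixed by the \<open>q\<close>-th power map, whereas \<open>a\<^sub>i\<close> is. Moreover, for the Fermat number \<open>N = q + 1\<close>, we get
  \<open>c\<^sub>i\<^sub>+\<^sub>1\<^sup>N = a\<^sub>i\<close> and \<open>a\<^sub>i\<^sub>+\<^sub>1\<^sup>N = a\<^sub>i\<^sup>3\<close>. As \<open>3\<close> divides no Fermat number of positive index,
  \<open>a\<^sub>i\<^sup>3\<close> has the same order as \<open>a\<^sub>i\<close> for \<open>i \<ge> 1\<close>, and each step multiplies the order by a
  divisor of \<open>N\<close>, which is nontrivial because the order of \<open>a\<^sub>i\<close> divides \<open>q - 1\<close>.
\<close>

section \<open>Orders of powers and iterated squares\<close>

lemma (in group) ord_eq_ord_pow_mult:
  assumes "x \<in> carrier G" and "n > 0"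
  obtains g where "g dvd n" "ord x = ord (x [^] n) * g"
proof
  show "gcd (ord x) n dvd n" by simp
  show "ord x = ord (x [^] n) * gcd (ord x) n"
    using ord_pow_gen[OF assms(1), of n] assms(2) by simp
qed

context field
begin

text \<open>\<open>HOL-Algebra\<close> defines the multiplicative group twice, and \<open>mult_order\<close> uses the copy
  without group lemmas.\<close>

lemma mult_order_eq_ord: "mult_order R x = group.ord (Multiplicative_Group.mult_of R) x"
  by (simp add: mult_order_def Multiplicative_Group.mult_of_def Ring_Divisibility.mult_of_def)

lemma mult_order_dvd_iff:
  assumes "x \<in> carrier R" "x \<noteq> \<zero>"
  shows "mult_order R x dvd n \<longleftrightarrow> x [^] n = \<one>"
  using group.pow_eq_id[OF field_mult_group, of x n] assms
  by (simp add: mult_order_eq_ord Multiplicative_Group.mult_of_simps)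

text \<open>Cancelling one factor \<open>x\<close> links orders with fixed points of the
  \<open>q\<close>-th power map.\<close>

lemma mult_order_dvd_pred_iff:
  assumes "x \<in> carrier R" "x \<noteq> \<zero>" "q > 0"
  shows "mult_order R x dvd q - 1 \<longleftrightarrow> x [^] q = x"
proof -
  have "x [^] q = x [^] (q - 1) \<otimes> x"
    using nat_pow_Suc[of x "q - 1"] assms(3) by simp
  moreover have "x [^] (q - 1) \<otimes> x = x \<longleftrightarrow> x [^] (q - 1) = \<one>"
    using m_rcancel[of x "x [^] (q - 1)" "\<one>"] assms(1,2) by simp
  ultimately show ?thesis
    using mult_order_dvd_iff[OF assms(1,2)] by simp
qed

lemma mult_order_factor:
  assumes "x \<in> carrier R" "x \<noteq> \<zero>" "n > 0"
  obtains g where "g dvd n" "mult_order R x = mult_order R (x [^] n) * g"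
  using group.ord_eq_ord_pow_mult[OF field_mult_group, of x n] assms
  by (auto simp: mult_order_eq_ord Multiplicative_Group.mult_of_simps)

lemma mult_order_pow_coprime:
  assumes "x \<in> carrier R" "x \<noteq> \<zero>" "coprime (mult_order R x) n" "n > 0"
  shows "mult_order R (x [^] n) = mult_order R x"
  using group.ord_pow_gen[OF field_mult_group, of x n] assms
  by (simp add: mult_order_eq_ord Multiplicative_Group.mult_of_simps)

text \<open>The map \<open>frob_sum n\<close> is the absolute trace of a field with \<open>2 ^ n\<close> elements.\<close>

primrec frob_sum :: "nat \<Rightarrow> 'a \<Rightarrow> 'a" where
  "frob_sum 0 x = \<zero>"
| "frob_sum (Suc n) x = frob_sum n x \<oplus> x [^] ((2::nat) ^ n)"

lemma frob_sum_closed [simp]: "x \<in> carrier R \<Longrightarrow> frob_sum n x \<in> carrier R"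
  by (induction n) auto

lemma frob_sum_zero [simp]: "frob_sum n \<zero> = \<zero>"
  by (induction n) (auto simp: nat_pow_zero)

text \<open>For \<open>n = m\<close> this splits the trace sum of a quadratic extension into two
  halves.\<close>

lemma frob_sum_add_index:
  assumes "x \<in> carrier R"
  shows "frob_sum (m + n) x = frob_sum m x \<oplus> frob_sum n (x [^] ((2::nat) ^ m))"
  using assms by (induction n) (auto simp: a_assoc nat_pow_pow power_add)

end

section \<open>Characteristic two\<close>

context conway_tower
begin

text \<open>The two-element subfield is closed under addition, and \<open>1 + 1 = 1\<close> would
  cancel to \<open>1 = 0\<close>.\<close>

lemma one_plus_one: "\<one> \<oplus> \<one> = \<zero>"
proof -
  note E = subringE[OF subfieldE(1)[OF base_subfield]]
  have "\<zero> \<in> L (-1)" "\<one> \<in> L (-1)" "\<one> \<oplus> \<one> \<in> L (-1)"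
    using E(2,3,7) by blast+
  moreover obtain u v where "L (-1) = {u, v}"
    using base_card card_2_iff by metis
  ultimately have "L (-1) = {\<zero>, \<one>}"
    using one_not_zero by auto
  hence "\<one> \<oplus> \<one> = \<zero> \<or> \<one> \<oplus> \<one> = \<one>"
    using \<open>\<one> \<oplus> \<one> \<in> L (-1)\<close> by auto
  thus ?thesis
    using one_not_zero add.l_cancel_one[of \<one> \<one>] by auto
qed

lemma add_self [simp]:
  assumes "x \<in> carrier R" shows "x \<oplus> x = \<zero>"
proof -
  have "x \<oplus> x = x \<otimes> (\<one> \<oplus> \<one>)" using assms by (simp add: r_distr)
  thus ?thesis using assms by (simp add: one_plus_one)
qed

lemma add_self_left [simp]:
  assumes "x \<in> carrier R" "y \<in> carrier R" shows "x \<oplus> (x \<oplus> y) = y"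
  using assms by (simp add: a_assoc[symmetric])

lemma square_add:
  assumes "x \<in> carrier R" "y \<in> carrier R"
  shows "(x \<oplus> y) [^] (2::nat) = x [^] (2::nat) \<oplus> y [^] (2::nat)"
  using assms by (simp add: numeral_2_eq_2 l_distr r_distr m_comm a_ac)

lemma frob_add:
  assumes "x \<in> carrier R" "y \<in> carrier R"
  shows "(x \<oplus> y) [^] ((2::nat) ^ n) = x [^] ((2::nat) ^ n) \<oplus> y [^] ((2::nat) ^ n)"
proof (induction n)
  case (Suc n)
  have *: "z [^] ((2::nat) ^ Suc n) = (z [^] ((2::nat) ^ n)) [^] (2::nat)" if "z \<in> carrier R" for z
    using that by (simp add: nat_pow_pow mult.commute)
  show ?case using assms Suc by (simp add: * square_add del: power_Suc)
qed (use assms in auto)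

lemma frob_sum_add:
  assumes "x \<in> carrier R" "y \<in> carrier R"
  shows "frob_sum n (x \<oplus> y) = frob_sum n x \<oplus> frob_sum n y"
  using assms by (induction n) (auto simp: frob_add a_ac)

lemma artin_schreier_iterate:
  assumes "x \<in> carrier R" "y \<in> carrier R" "x [^] (2::nat) = x \<oplus> y"
  shows "x [^] ((2::nat) ^ n) = x \<oplus> frob_sum n y"
proof (induction n)
  case (Suc n)
  have "x [^] ((2::nat) ^ Suc n) = (x [^] (2::nat)) [^] ((2::nat) ^ n)"
    using assms(1) by (simp add: nat_pow_pow)
  thus ?case using assms Suc by (simp add: frob_add a_assoc)
qed (use assms in auto)

section \<open>Products of the generators\<close>

definition a :: "nat \<Rightarrow> 'a" where "a k = tower_prod R c (int k)"

lemma c_nat_closed [simp]: "c (int k) \<in> carrier R"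
  using c_closed[of "int k - 1"] by simp

lemma c_Suc_closed [simp]: "c (1 + int k) \<in> carrier R"
  using c_nat_closed[of "Suc k"] by simp

lemma c_range_closed: "c \<in> {0..int k} \<rightarrow> carrier R"
proof
  fix j assume "j \<in> {0..int k}"
  thus "c j \<in> carrier R" using c_nat_closed[of "nat j"] by simp
qed

lemma a_in_carrier [simp]: "a k \<in> carrier R"
  unfolding a_def tower_prod_def using c_range_closed by (rule finprod_closed)

lemma a_0: "a 0 = c 0"
  using c_nat_closed[of 0] by (simp add: a_def tower_prod_def)

lemma a_Suc: "a (Suc k) = a k \<otimes> c (int (Suc k))"
proof -
  have "{0..int (Suc k)} = insert (int (Suc k)) {0..int k}" by auto
  thus ?thesis
    using c_range_closed[of k] c_nat_closed[of "Suc k"]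
    by (simp add: a_def tower_prod_def m_comm finprod_closed del: of_nat_Suc)
qed

lemma square_eq_if_root:
  assumes "x \<in> carrier R" "y \<in> carrier R" "x [^] (2::nat) \<oplus> x \<oplus> y = \<zero>"
  shows "x [^] (2::nat) = x \<oplus> y"
proof -
  have "x [^] (2::nat) = x [^] (2::nat) \<oplus> ((x \<oplus> y) \<oplus> (x \<oplus> y))" using assms(1,2) by simp
  also have "\<dots> = (x [^] (2::nat) \<oplus> x \<oplus> y) \<oplus> (x \<oplus> y)" using assms(1,2) by (simp add: a_assoc)
  finally show ?thesis using assms by simp
qed

lemma c_0_square: "c 0 [^] (2::nat) = c 0 \<oplus> \<one>"
  using c_root[of "-1"] c_nat_closed[of 0] by (intro square_eq_if_root) (auto simp: base_one)

lemma c_0_mult_self: "c 0 \<otimes> c 0 = c 0 \<oplus> \<one>"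
  using c_0_square c_nat_closed[of 0] by (simp add: numeral_2_eq_2)

lemma c_Suc_square: "c (int (Suc k)) [^] (2::nat) = c (int (Suc k)) \<oplus> a k"
proof (rule square_eq_if_root)
  have "{-1..int k} = insert (-1) {0..int k}" by auto
  hence "(\<Otimes>j\<in>{-1..int k}. c j) = a k"
    using c_range_closed[of k] by (simp add: a_def tower_prod_def base_one finprod_closed)
  thus "c (int (Suc k)) [^] (2::nat) \<oplus> c (int (Suc k)) \<oplus> a k = \<zero>"
    using c_root[of "int k"] by (simp add: add.commute)
qed auto

section \<open>Traces and the action of Frobenius\<close>

lemma frob_c_if_trace:
  assumes "frob_sum (2 ^ Suc k) (a k) = \<one>"
  shows "c (int (Suc k)) [^] ((2::nat) ^ 2 ^ Suc k) = c (int (Suc k)) \<oplus> \<one>"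
  using artin_schreier_iterate[OF _ _ c_Suc_square, of k "2 ^ Suc k"] assms by (simp del: of_nat_Suc)

text \<open>The induction is joint: the trace of \<open>a k\<close> fixes how the
  \<open>q\<close>-th power map moves the next \<open>c\<close>, and invariance of
  \<open>a k\<close> then yields its effect on \<open>a (Suc k)\<close>.\<close>

lemma trace_and_frob_a:
  "frob_sum (2 ^ Suc k) (a k) = \<one> \<and> a k [^] ((2::nat) ^ 2 ^ Suc k) = a k"
proof (induction k)
  case 0
  have c0: "c 0 \<in> carrier R" using c_nat_closed[of 0] by simp
  have "(c 0 [^] (2::nat)) [^] (2::nat) = c 0"
    using c0 by (simp add: c_0_square square_add a_assoc)
  hence "c 0 [^] (4::nat) = c 0" using c0 by (simp add: nat_pow_pow)
  moreover have "frob_sum 2 (c 0) = \<one>"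
    using c0 by (simp add: numeral_2_eq_2 c_0_mult_self)
  ultimately show ?case by (simp add: a_0)
next
  case (Suc k)
  let ?m = "2 ^ Suc k :: nat" and ?x = "c (int (Suc k))"
  let ?q = "(2::nat) ^ ?m"
  have x: "?x \<in> carrier R" by (rule c_nat_closed)
  have tr: "frob_sum ?m (a k) = \<one>" and fa: "a k [^] ?q = a k" using Suc by auto
  have fx: "?x [^] ?q = ?x \<oplus> \<one>" by (rule frob_c_if_trace[OF tr])
  have fz: "a (Suc k) [^] ?q = a (Suc k) \<oplus> a k"
    using x by (simp add: a_Suc nat_pow_distrib fa fx r_distr del: of_nat_Suc power_Suc)
  have mm: "2 ^ Suc (Suc k) = ?m + ?m" by simp
  \<comment> \<open>The second half of the sum is the first half taken at
    \<open>a (Suc k) \<oplus> a k\<close>; the terms in \<open>a (Suc k)\<close> cancel and the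
    trace of \<open>a k\<close> remains.\<close>
  have "frob_sum (?m + ?m) (a (Suc k)) = \<one>"
    by (simp add: frob_sum_add_index fz frob_sum_add tr del: of_nat_Suc power_Suc)
  moreover have "a (Suc k) [^] ((2::nat) ^ (?m + ?m)) = (a (Suc k) [^] ?q) [^] ?q"
    by (simp add: nat_pow_pow power_add del: of_nat_Suc power_Suc)
  hence "a (Suc k) [^] ((2::nat) ^ (?m + ?m)) = a (Suc k)"
    by (simp add: fz frob_add fa a_assoc del: of_nat_Suc power_Suc)
  ultimately show ?case unfolding mm by blast
qed

lemma frob_a: "a k [^] ((2::nat) ^ 2 ^ Suc k) = a k"
  using trace_and_frob_a by blast

lemma frob_c: "c (int (Suc k)) [^] ((2::nat) ^ 2 ^ Suc k) = c (int (Suc k)) \<oplus> \<one>"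
  using trace_and_frob_a by (intro frob_c_if_trace) blast

text \<open>Its trace is \<open>1\<close>, whereas \<open>0\<close> has trace
  \<open>0\<close>.\<close>

lemma a_nonzero: "a k \<noteq> \<zero>"
  using trace_and_frob_a[of k] by auto

lemma c_Suc_nonzero: "c (int (Suc k)) \<noteq> \<zero>"
  using a_nonzero[of "Suc k"] a_Suc[of k] by auto

lemma frob_c_neq: "c (int (Suc k)) [^] ((2::nat) ^ 2 ^ Suc k) \<noteq> c (int (Suc k))"
  unfolding frob_c using add_self_left[of "c (int (Suc k))" \<one>] add_self[of "c (int (Suc k))"]
  by (metis c_nat_closed one_closed one_not_zero)

lemma frob_a_Suc_neq: "a (Suc k) [^] ((2::nat) ^ 2 ^ Suc k) \<noteq> a (Suc k)"
proof
  let ?q = "(2::nat) ^ 2 ^ Suc k" and ?x = "c (int (Suc k))"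
  assume "a (Suc k) [^] ?q = a (Suc k)"
  hence "a k \<otimes> ?x [^] ?q = a k \<otimes> ?x"
    by (simp add: a_Suc nat_pow_distrib frob_a del: of_nat_Suc power_Suc)
  thus False
    using m_lcancel[OF a_nonzero[of k], of "?x [^] ?q" ?x] frob_c_neq[of k] by auto
qed

text \<open>This power is a norm: the product of the conjugates \<open>x\<close> and
  \<open>x + 1\<close> is the constant term of their quadratic polynomial.\<close>

lemma c_Suc_pow_fermat: "c (int (Suc k)) [^] fermat_number (Suc k) = a k"
proof -
  let ?x = "c (int (Suc k))"
  have "?x [^] fermat_number (Suc k) = (?x \<oplus> \<one>) \<otimes> ?x"
    using c_nat_closed[of "Suc k"] frob_c[of k] by (simp add: fermat_number_def del: of_nat_Suc power_Suc)
  also have "\<dots> = ?x [^] (2::nat) \<oplus> ?x"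
    using c_nat_closed[of "Suc k"] by (simp add: numeral_2_eq_2 l_distr del: of_nat_Suc)
  also have "\<dots> = a k"
    using c_nat_closed[of "Suc k"] unfolding c_Suc_square by (simp add: a_ac del: of_nat_Suc)
  finally show ?thesis .
qed

lemma a_Suc_pow_fermat: "a (Suc k) [^] fermat_number (Suc k) = a k [^] (3::nat)"
proof -
  have "a k [^] fermat_number (Suc k) = a k \<otimes> a k"
    using frob_a[of k] by (simp add: fermat_number_def del: power_Suc)
  thus ?thesis
    by (simp add: a_Suc nat_pow_distrib c_Suc_pow_fermat numeral_3_eq_3 del: of_nat_Suc)
qed

lemma a_0_cube: "a 0 [^] (3::nat) = \<one>"
proof -
  have "c 0 \<in> carrier R" using c_nat_closed[of 0] by simp
  hence "c 0 [^] (3::nat) = \<one>"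
    by (simp add: numeral_3_eq_3 c_0_mult_self l_distr a_ac)
  thus ?thesis by (simp add: a_0)
qed

section \<open>Factoring the orders\<close>

lemma mult_order_a_dvd: "mult_order R (a k) dvd 2 ^ 2 ^ Suc k - 1"
  using mult_order_dvd_pred_iff[of "a k"] a_nonzero frob_a by simp

text \<open>If \<open>g = 1\<close>, the order of \<open>x\<close> would divide that of
  \<open>a k\<close>, hence \<open>q - 1\<close> for \<open>q = 2 ^ 2 ^ Suc k\<close>, and the
  \<open>q\<close>-th power map would fix \<open>x\<close>.\<close>

lemma mult_order_step:
  assumes "x \<in> carrier R" "x \<noteq> \<zero>" "x [^] ((2::nat) ^ 2 ^ Suc k) \<noteq> x"
    and "mult_order R (x [^] fermat_number (Suc k)) dvd mult_order R (a k)"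
  obtains g where "g dvd fermat_number (Suc k)" "g > 1"
    "mult_order R x = mult_order R (x [^] fermat_number (Suc k)) * g"
proof -
  have pos: "fermat_number (Suc k) > 0" by (simp add: fermat_number_def)
  obtain g where g: "g dvd fermat_number (Suc k)"
      "mult_order R x = mult_order R (x [^] fermat_number (Suc k)) * g"
    using mult_order_factor[OF assms(1,2) pos] by blast
  have "\<not> mult_order R x dvd 2 ^ 2 ^ Suc k - 1"
    using mult_order_dvd_pred_iff[OF assms(1,2)] assms(3) by simp
  hence "g \<noteq> 1"
    using g(2) assms(4) mult_order_a_dvd[of k] dvd_trans by auto
  moreover have "g \<noteq> 0" using g(1) pos by (metis dvd_0_left less_irrefl)
  ultimately show ?thesis using that g by simp
qed

lemma coprime_3_fermat: "coprime (fermat_number (Suc k)) 3"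
proof -
  have "(2::nat) ^ 2 ^ Suc k mod 3 = (2 ^ 2) ^ 2 ^ k mod 3" by (simp add: power_mult)
  also have "\<dots> = 1" using power_mod[of "2 ^ 2 :: nat" 3 "2 ^ k"] by simp
  finally have "fermat_number (Suc k) mod 3 = 2"
    unfolding fermat_number_def by presburger
  moreover have "coprime (2::nat) 3" by simp
  ultimately show ?thesis by (metis coprime_mod_left_iff zero_neq_numeral)
qed

lemma mult_order_a:
  "\<exists>\<beta>. (\<forall>j\<in>{1..Suc k}. \<beta> j dvd fermat_number j \<and> \<beta> j > 1) \<and>
        mult_order R (a (Suc k)) = (\<Prod>j=1..Suc k. \<beta> j)"
proof (induction k)
  case 0
  \<comment> \<open>The chain ends here, as \<open>a 0\<close> is a cube root of unity; hence index
    \<open>0\<close> contributes no factor.\<close>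
  have 1: "mult_order R (a (Suc 0) [^] fermat_number (Suc 0)) = 1"
    using mult_order_dvd_iff[of \<one> 1] unfolding a_Suc_pow_fermat a_0_cube by simp
  then obtain g where "g dvd fermat_number (Suc 0)" "g > 1" "mult_order R (a (Suc 0)) = g"
    using mult_order_step[OF a_in_carrier a_nonzero frob_a_Suc_neq[of 0]] by auto
  thus ?case by (intro exI[of _ "\<lambda>_. g"]) simp
next
  case (Suc k)
  then obtain \<beta> where \<beta>: "\<forall>j\<in>{1..Suc k}. \<beta> j dvd fermat_number j \<and> \<beta> j > 1"
    and ord: "mult_order R (a (Suc k)) = (\<Prod>j=1..Suc k. \<beta> j)" by blast
  \<comment> \<open>Coprimality to \<open>3\<close> ensures that cubing preserves the order.\<close>
  have "coprime (\<beta> j) 3" if "j \<in> {1..Suc k}" for j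
    using \<beta> that coprime_3_fermat[of "j - 1"] coprime_divisors[of "\<beta> j" "fermat_number j" 3 3] by auto
  hence "coprime (mult_order R (a (Suc k))) 3"
    unfolding ord by (intro prod_coprime_left) auto
  hence same: "mult_order R (a (Suc (Suc k)) [^] fermat_number (Suc (Suc k))) = mult_order R (a (Suc k))"
    unfolding a_Suc_pow_fermat using a_nonzero by (intro mult_order_pow_coprime) auto
  obtain g where "g dvd fermat_number (Suc (Suc k))" "g > 1"
    "mult_order R (a (Suc (Suc k))) = (\<Prod>j=1..Suc k. \<beta> j) * g"
    using mult_order_step[OF a_in_carrier a_nonzero frob_a_Suc_neq[of "Suc k"]] same ord by auto
  thus ?case using \<beta> by (intro exI[of _ "\<beta>(Suc (Suc k) := g)"]) (auto simp: atLeastAtMostSuc_conv)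
qed

text \<open>One step leads from this \<open>c\<close> to \<open>a (Suc k)\<close>, whose order is
  already factored. The index starts at \<open>2\<close> because \<open>c 1\<close> leads to
  \<open>a 0\<close>, which has order \<open>3\<close>.\<close>

lemma mult_order_c:
  "\<exists>\<alpha>. (\<forall>j\<in>{1..Suc (Suc k)}. \<alpha> j dvd fermat_number j \<and> \<alpha> j > 1) \<and>
        mult_order R (c (int (Suc (Suc k)))) = (\<Prod>j=1..Suc (Suc k). \<alpha> j)"
proof -
  obtain \<beta> where \<beta>: "\<forall>j\<in>{1..Suc k}. \<beta> j dvd fermat_number j \<and> \<beta> j > 1"
    and ord: "mult_order R (a (Suc k)) = (\<Prod>j=1..Suc k. \<beta> j)"
    using mult_order_a by blast
  obtain g where "g dvd fermat_number (Suc (Suc k))" "g > 1"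
    "mult_order R (c (int (Suc (Suc k)))) = (\<Prod>j=1..Suc k. \<beta> j) * g"
    using mult_order_step[OF c_nat_closed c_Suc_nonzero frob_c_neq[of "Suc k"]] ord
    unfolding c_Suc_pow_fermat by auto
  thus ?thesis using \<beta>
    by (intro exI[of _ "\<beta>(Suc (Suc k) := g)"]) (auto simp: atLeastAtMostSuc_conv)
qed

end

theorem theorem3:
  fixes R :: "('a, 'b) ring_scheme"
    and L :: "int \<Rightarrow> 'a set" and c :: "int \<Rightarrow> 'a" and i :: nat
  assumes "conway_tower R L c"
    and "i \<ge> 2"
  shows "(\<exists>\<alpha> :: nat \<Rightarrow> nat.
            (\<forall>j\<in>{1..i}. \<alpha> j dvd fermat_number j \<and> \<alpha> j > 1) \<and>
            mult_order R (c (int i)) = (\<Prod>j=1..i. \<alpha> j)) \<and>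
         (\<exists>\<beta> :: nat \<Rightarrow> nat.
            (\<forall>j\<in>{1..i}. \<beta> j dvd fermat_number j \<and> \<beta> j > 1) \<and>
            mult_order R (tower_prod R c (int i)) = (\<Prod>j=1..i. \<beta> j))"
proof -
  interpret conway_tower R L c by (rule assms(1))
  obtain k where "i = Suc (Suc k)"
    using assms(2) by (metis add_2_eq_Suc le_Suc_ex)
  thus ?thesis using mult_order_c[of k] mult_order_a[of "Suc k"] by (simp only: a_def)
qed

end
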